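(* Let $a<b$ be real numbers and let $f:[a,b]\to\mathbb{R}$ be continuous and such that $$M:=\max_{a\le t\le b} f(t)=-\min_{a\le t\le b} f(t)>0 .$$ 1. There exist an integer $k\ge 1$, $\varepsilon\in\{-1,1\}$ and pairs $(t_i^-,t_i^+)\in[a,b]^2$, $i=0,\dots,k$, such that $$a\le t_0^-\le t_0^+<t_1^-\le t_1^+<t_2^-\le t_2^+<\cdots<t_k^-\le t_k^+\le b,$$ $$\varepsilon M=(-1)^i f(t_i^-)=(-1)^i f(t_i^+),\qquad i=0,1,\dots,k,$$ $$-M<\varepsilon(-1)^i f(t)\le M\quad\text{whenever } t\in[t_i^-,t_i^+] \text{ for some } i\in\{0,\dots,k\},$$ $$|f(t)|<M\quad\text{for all other } t\in[a,b].$$ The quantities $k,\varepsilon,t_i^-,t_i^+$ are uniquely determined by these conditions. 2. $\|f-p\|\ge\|f\|$ for every polynomial function $p$ of degree at most $k-1$. 3. For $i=0,1,\dots,k-1$ let $\xi_i$ be chosen arbitrarily in $(t_i^+,t_{i+1}^-)$, and consider the polynomial function of degree $k$ $$\gamma(t)=\varepsilon\prod_{i=0}^{k-1}(\xi_i-t).$$ Then, for all $\lambda>0$ small enough, $\|f-\lambda\gamma\|<\|f\|$.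
   Context: For a continuous $g:[a,b]\to\mathbb{R}$, $\|g\|=\max_{t\in[a,b]}|g(t)|$. *)

theory Defs
  imports "HOL-Analysis.Analysis" "HOL-Computational_Algebra.Polynomial"
begin

text \<open>Maxima and minima over the compact interval are written with \<open>SUP\<close> and \<open>INF\<close>, because
  \<^const>\<open>Max\<close> and \<^const>\<open>Min\<close> are only meaningful for finite sets. For continuous functions
  and \<open>a \<le> b\<close> they are attained, see the lemmas below.\<close>

definition unorm :: "real \<Rightarrow> real \<Rightarrow> (real \<Rightarrow> real) \<Rightarrow> real" where
  "unorm a b g = (SUP t\<in>{a..b}. \<bar>g t\<bar>)"

lemma SUP_is_maximum:
  fixes g :: "real \<Rightarrow> real"
  assumes "a \<le> b" "continuous_on {a..b} g"
  shows "(\<exists>s\<in>{a..b}. g s = (SUP t\<in>{a..b}. g t)) \<and> (\<forall>s\<in>{a..b}. g s \<le> (SUP t\<in>{a..b}. g t))"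
proof -
  obtain s where s: "s \<in> {a..b}" "\<forall>t\<in>{a..b}. g t \<le> g s"
    using continuous_attains_sup[of "{a..b}" g] assms by auto
  then have "(SUP t\<in>{a..b}. g t) = g s"
    by (intro cSup_eq_maximum) auto
  then show ?thesis using s by auto
qed

lemma INF_is_minimum:
  fixes g :: "real \<Rightarrow> real"
  assumes "a \<le> b" "continuous_on {a..b} g"
  shows "(\<exists>s\<in>{a..b}. g s = (INF t\<in>{a..b}. g t)) \<and> (\<forall>s\<in>{a..b}. (INF t\<in>{a..b}. g t) \<le> g s)"
proof -
  obtain s where s: "s \<in> {a..b}" "\<forall>t\<in>{a..b}. g s \<le> g t"
    using continuous_attains_inf[of "{a..b}" g] assms by auto
  then have "(INF t\<in>{a..b}. g t) = g s"
    by (intro cInf_eq_minimum) auto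
  then show ?thesis using s by auto
qed

lemma unorm_is_maximum:
  assumes "a \<le> b" "continuous_on {a..b} g"
  shows "(\<exists>s\<in>{a..b}. \<bar>g s\<bar> = unorm a b g) \<and> (\<forall>s\<in>{a..b}. \<bar>g s\<bar> \<le> unorm a b g)"
  unfolding unorm_def using assms by (intro SUP_is_maximum continuous_intros)

text \<open>\<open>u i\<close> and \<open>v i\<close> stand for $t_i^-$ and $t_i^+$; only their values at \<open>i \<le> k\<close> matter.\<close>

definition alternation ::
  "real \<Rightarrow> real \<Rightarrow> (real \<Rightarrow> real) \<Rightarrow> real \<Rightarrow> nat \<Rightarrow> real \<Rightarrow> (nat \<Rightarrow> real) \<Rightarrow> (nat \<Rightarrow> real) \<Rightarrow> bool" where
  "alternation a b f M k \<epsilon> u v \<longleftrightarrow>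
     k \<ge> 1 \<and> \<epsilon> \<in> {-1, 1} \<and>
     (\<forall>i\<le>k. u i \<in> {a..b} \<and> v i \<in> {a..b}) \<and>
     (\<forall>i\<le>k. u i \<le> v i) \<and> (\<forall>i<k. v i < u (Suc i)) \<and>
     (\<forall>i\<le>k. (-1) ^ i * f (u i) = \<epsilon> * M \<and> (-1) ^ i * f (v i) = \<epsilon> * M) \<and>
     (\<forall>i\<le>k. \<forall>t\<in>{u i..v i}. - M < \<epsilon> * (-1) ^ i * f t \<and> \<epsilon> * (-1) ^ i * f t \<le> M) \<and>
     (\<forall>t\<in>{a..b}. (\<forall>i\<le>k. t \<notin> {u i..v i}) \<longrightarrow> \<bar>f t\<bar> < M)"

end

(* Call t extremal if |f t| = M. The interval is swept from left to right: the blocks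
   [t_i^-, t_i^+] are the hulls of the maximal runs of extremal points of equal sign, and uniform
   continuity keeps points of opposite sign a fixed distance apart, so that there are finitely many
   blocks. Part 2: if the norm of f - p were smaller than M, then p would have the sign of f at
   the k + 1 points t_i^-, hence k zeros. Part 3: \<gamma> has the sign of f at every extremal point,
   which by compactness is enough for subtracting a small multiple of \<gamma> to lower the norm. *)
theory Submission imports Defs begin

(* Unlike alternation, this allows k = 0; the extra case makes the induction over intervals work. *)
definition sign_blocks ::
  "real \<Rightarrow> real \<Rightarrow> (real \<Rightarrow> real) \<Rightarrow> real \<Rightarrow> nat \<Rightarrow> real \<Rightarrow> (nat \<Rightarrow> real) \<Rightarrow> (nat \<Rightarrow> real) \<Rightarrow> bool" where
  "sign_blocks a b f M k \<epsilon> u v \<longleftrightarrow>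
     \<epsilon> \<in> {-1, 1} \<and>
     (\<forall>i\<le>k. u i \<in> {a..b} \<and> v i \<in> {a..b}) \<and>
     (\<forall>i\<le>k. u i \<le> v i) \<and> (\<forall>i<k. v i < u (Suc i)) \<and>
     (\<forall>i\<le>k. (-1) ^ i * f (u i) = \<epsilon> * M \<and> (-1) ^ i * f (v i) = \<epsilon> * M) \<and>
     (\<forall>i\<le>k. \<forall>t\<in>{u i..v i}. - M < \<epsilon> * (-1) ^ i * f t \<and> \<epsilon> * (-1) ^ i * f t \<le> M) \<and>
     (\<forall>t\<in>{a..b}. (\<forall>i\<le>k. t \<notin> {u i..v i}) \<longrightarrow> \<bar>f t\<bar> < M)"

lemma alternation_iff_sign_blocks:
  "alternation a b f M k \<epsilon> u v \<longleftrightarrow> 1 \<le> k \<and> sign_blocks a b f M k \<epsilon> u v"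
  unfolding alternation_def sign_blocks_def by blast

section \<open>First and last points of level sets on a compact interval\<close>

lemma compact_closed_subset_Icc:
  fixes S :: "real set"
  assumes "closed S" "S \<subseteq> {c..d}"
  shows "compact S"
  using assms bounded_subset[OF bounded_closed_interval] by (auto simp: compact_eq_bounded_closed)

text \<open>A closed subset of a compact interval attains its infimum. With its mirror image below,
  this supplies all block ends in the existence proof, applied to \<open>\<bar>f t\<bar>\<close> and
  to \<open>\<epsilon> * f t\<close>.\<close>

lemma level_set_least:
  fixes g :: "real \<Rightarrow> real"
  assumes "continuous_on {c..d} g" "s \<in> {c..d}" "g s = m"
  obtains w where "w \<in> {c..d}" "g w = m" "\<And>t. t \<in> {c..d} \<Longrightarrow> g t = m \<Longrightarrow> w \<le> t"
proof -
  have "closed {t \<in> {c..d}. g t = m}"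
    using assms(1) by (intro continuous_closed_preimage_constant) auto
  then have "compact {t \<in> {c..d}. g t = m}"
    by (rule compact_closed_subset_Icc) auto
  then obtain w where "w \<in> {t \<in> {c..d}. g t = m}" "\<forall>t\<in>{t \<in> {c..d}. g t = m}. w \<le> t"
    using compact_attains_inf[of "{t \<in> {c..d}. g t = m}"] assms(2,3) by blast
  then show ?thesis using that by auto
qed

lemma level_set_greatest:
  fixes g :: "real \<Rightarrow> real"
  assumes "continuous_on {c..d} g" "s \<in> {c..d}" "g s = m"
  obtains w where "w \<in> {c..d}" "g w = m" "\<And>t. t \<in> {c..d} \<Longrightarrow> g t = m \<Longrightarrow> t \<le> w"
proof -
  have "closed {t \<in> {c..d}. g t = m}"
    using assms(1) by (intro continuous_closed_preimage_constant) auto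
  then have "compact {t \<in> {c..d}. g t = m}"
    by (rule compact_closed_subset_Icc) auto
  then obtain w where "w \<in> {t \<in> {c..d}. g t = m}" "\<forall>t\<in>{t \<in> {c..d}. g t = m}. t \<le> w"
    using compact_attains_sup[of "{t \<in> {c..d}. g t = m}"] assms(2,3) by blast
  then show ?thesis using that by auto
qed

section \<open>Order of the blocks and position of the extremal points\<close>

context
  fixes a b M :: real and f :: "real \<Rightarrow> real" and k :: nat and \<epsilon> :: real and u v :: "nat \<Rightarrow> real"
  assumes blocks: "sign_blocks a b f M k \<epsilon> u v"
begin

lemma sign_blocks_sign: "\<epsilon> = -1 \<or> \<epsilon> = 1"
  using blocks unfolding sign_blocks_def by auto

lemma sign_blocks_bounds:
  assumes "i \<le> k"
  shows "a \<le> u i" "u i \<le> v i" "v i \<le> b"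
  using blocks assms unfolding sign_blocks_def by auto

lemma sign_blocks_gap: "i < k \<Longrightarrow> v i < u (Suc i)"
  using blocks unfolding sign_blocks_def by auto

lemma sign_blocks_value:
  assumes "i \<le> k"
  shows "f (u i) = \<epsilon> * (-1) ^ i * M" "f (v i) = \<epsilon> * (-1) ^ i * M"
proof -
  have "(-1) ^ i * ((-1) ^ i * x) = x" for x :: real
    by (simp add: power_mult_distrib[symmetric] mult.assoc[symmetric])
  moreover have "(-1) ^ i * f (u i) = \<epsilon> * M" "(-1) ^ i * f (v i) = \<epsilon> * M"
    using blocks assms unfolding sign_blocks_def by auto
  ultimately show "f (u i) = \<epsilon> * (-1) ^ i * M" "f (v i) = \<epsilon> * (-1) ^ i * M"
    by (metis mult.assoc mult.commute)+
qed

lemma sign_blocks_inside: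
  "i \<le> k \<Longrightarrow> u i \<le> t \<Longrightarrow> t \<le> v i \<Longrightarrow> - M < \<epsilon> * (-1) ^ i * f t"
  using blocks unfolding sign_blocks_def by auto

lemma sign_blocks_extremal:
  assumes "t \<in> {a..b}" "\<bar>f t\<bar> = M"
  obtains i where "i \<le> k" "u i \<le> t" "t \<le> v i"
proof -
  have "\<forall>t\<in>{a..b}. (\<forall>i\<le>k. t \<notin> {u i..v i}) \<longrightarrow> \<bar>f t\<bar> < M"
    using blocks by (simp add: sign_blocks_def)
  with assms have "\<exists>i\<le>k. t \<in> {u i..v i}" by (metis less_irrefl)
  then show ?thesis using that by auto
qed

lemma sign_blocks_right_less_left:
  assumes "i < j" "j \<le> k"
  shows "v i < u j"
  using assms
proof (induction j)
  case (Suc j)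
  show ?case
  proof (cases "i = j")
    case False
    then have "v i < u j" using Suc by auto
    also have "u j \<le> v j" using sign_blocks_bounds Suc by auto
    also have "v j < u (Suc j)" using sign_blocks_gap Suc by auto
    finally show ?thesis .
  qed (use sign_blocks_gap Suc in auto)
qed auto

lemma sign_blocks_left_mono:
  assumes "i \<le> j" "j \<le> k"
  shows "u i \<le> u j"
  using sign_blocks_right_less_left[of i j] sign_blocks_bounds(2)[of i] assms
  by (cases "i = j") auto

lemma sign_blocks_right_mono:
  assumes "i \<le> j" "j \<le> k"
  shows "v i \<le> v j"
  using sign_blocks_right_less_left[of i j] sign_blocks_bounds(2)[of j] assms
  by (cases "i = j") auto

lemma sign_blocks_first:
  assumes "t \<in> {a..b}" "\<bar>f t\<bar> = M"
  shows "u 0 \<le> t"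
proof -
  obtain i where "i \<le> k" "u i \<le> t" using sign_blocks_extremal[OF assms] .
  then show ?thesis using sign_blocks_left_mono[of 0 i] by simp
qed

text \<open>The blocks are ordered, so an extremal point beyond block \<open>i\<close> lies in some
  block \<open>j > i\<close>. This is what forces two decompositions to continue together.\<close>

lemma sign_blocks_next:
  assumes "t \<in> {a..b}" "\<bar>f t\<bar> = M" "i \<le> k" "v i < t"
  shows "i < k \<and> u (Suc i) \<le> t"
proof -
  obtain j where j: "j \<le> k" "u j \<le> t" "t \<le> v j"
    using sign_blocks_extremal[OF assms(1,2)] .
  then have "i < j" using sign_blocks_right_mono[of j i] assms by force
  then show ?thesis using j sign_blocks_left_mono[of "Suc i" j] by auto
qed

text \<open>An extremal point has one of the values \<open>M\<close> and \<open>- M\<close>; the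
  strict lower bound inside its block rules out the one of the wrong sign.\<close>

lemma sign_blocks_extremal_value:
  assumes "t \<in> {a..b}" "\<bar>f t\<bar> = M"
  obtains i where "i \<le> k" "u i \<le> t" "t \<le> v i" "f t = \<epsilon> * (-1) ^ i * M"
proof -
  obtain i where i: "i \<le> k" "u i \<le> t" "t \<le> v i"
    using sign_blocks_extremal[OF assms] .
  have "\<epsilon> * (-1) ^ i = 1 \<or> \<epsilon> * (-1) ^ i = -1"
    using sign_blocks_sign by (cases "even i") auto
  then have "f t = \<epsilon> * (-1) ^ i * M"
    using sign_blocks_inside[OF i] assms(2) by (elim disjE) auto
  then show ?thesis using that i by blast
qed

lemma sign_blocks_abs_value:
  assumes "0 < M" "i \<le> k"
  shows "\<bar>f (u i)\<bar> = M" "\<bar>f (v i)\<bar> = M"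
  using sign_blocks_value[OF assms(2)] sign_blocks_sign assms(1)
  by (auto simp: abs_mult power_abs)

end

section \<open>Uniqueness of the blocks\<close>

text \<open>If the second block \<open>i\<close> extended beyond \<open>v i\<close>, its extremal
  right end would lie at or after \<open>u (Suc i)\<close>. Then \<open>u (Suc i)\<close>, where
  \<open>f\<close> has the opposite sign, would lie inside that block, against the strict lower
  bound there.\<close>

lemma sign_blocks_unique_aux:
  assumes A: "sign_blocks a b f M k \<epsilon> u v" and B: "sign_blocks a b f M k' \<epsilon> u' v'"
    and "0 < M" "i \<le> k" "i \<le> k'" "u i = u' i"
  shows "v' i \<le> v i"
proof (rule ccontr)
  assume "\<not> v' i \<le> v i"
  then have less: "v i < v' i" by simp
  have "v' i \<in> {a..b}" using sign_blocks_bounds[OF B \<open>i \<le> k'\<close>] by auto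
  then have n: "i < k" "u (Suc i) \<le> v' i"
    using sign_blocks_next[OF A _ sign_blocks_abs_value(2)[OF B \<open>0 < M\<close> \<open>i \<le> k'\<close>] \<open>i \<le> k\<close> less]
    by auto
  have "u' i \<le> u (Suc i)"
    using sign_blocks_left_mono[OF A, of i "Suc i"] n assms by auto
  from sign_blocks_inside[OF B \<open>i \<le> k'\<close> this n(2)]
  have "- M < \<epsilon> * (-1) ^ i * f (u (Suc i))" .
  also have "\<dots> = - ((\<epsilon> * (-1) ^ i)\<^sup>2 * M)"
    using sign_blocks_value(1)[OF A, of "Suc i"] n by (simp add: power2_eq_square)
  also have "(\<epsilon> * (-1) ^ i)\<^sup>2 = 1"
    using sign_blocks_sign[OF A] by (cases "even i") auto
  finally show False by simp
qed

text \<open>In any decomposition \<open>u 0\<close> is the least extremal point, and the sign of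
  \<open>f\<close> there is the sign of the decomposition.\<close>

lemma sign_blocks_first_eq:
  assumes A: "sign_blocks a b f M k \<epsilon> u v" and B: "sign_blocks a b f M k' \<epsilon>' u' v'"
    and "0 < M"
  shows "u 0 = u' 0" "\<epsilon> = \<epsilon>'"
proof -
  have "u 0 \<in> {a..b}" "u' 0 \<in> {a..b}"
    using sign_blocks_bounds[OF A, of 0] sign_blocks_bounds[OF B, of 0] by auto
  then show *: "u 0 = u' 0"
    using sign_blocks_first[OF A, of "u' 0"] sign_blocks_first[OF B, of "u 0"]
      sign_blocks_abs_value(1)[OF A \<open>0 < M\<close>, of 0] sign_blocks_abs_value(1)[OF B \<open>0 < M\<close>, of 0]
    by auto
  then show "\<epsilon> = \<epsilon>'"
    using sign_blocks_value(1)[OF A, of 0] sign_blocks_value(1)[OF B, of 0] \<open>0 < M\<close> by auto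
qed

text \<open>The conclusion includes \<open>i \<le> k'\<close> so that taking \<open>i = k\<close>
  yields \<open>k \<le> k'\<close>; exchanging the roles then gives equality of the two
  counts.\<close>

lemma sign_blocks_unique_step:
  assumes A: "sign_blocks a b f M k \<epsilon> u v" and B: "sign_blocks a b f M k' \<epsilon>' u' v'"
    and "0 < M" "i \<le> k"
  shows "i \<le> k' \<and> u i = u' i \<and> v i = v' i"
  using \<open>i \<le> k\<close>
proof (induction i)
  case 0
  have B: "sign_blocks a b f M k' \<epsilon> u' v'" and u: "u 0 = u' 0"
    using B sign_blocks_first_eq[OF A B \<open>0 < M\<close>] by auto
  then show ?case
    using sign_blocks_unique_aux[OF A B \<open>0 < M\<close>, of 0] sign_blocks_unique_aux[OF B A \<open>0 < M\<close>, of 0]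
    by auto
next
  case (Suc i)
  have B: "sign_blocks a b f M k' \<epsilon> u' v'"
    using B sign_blocks_first_eq[OF A B \<open>0 < M\<close>] by auto
  have i: "i < k" "i \<le> k'" "v i = v' i" using Suc by auto
  have "u (Suc i) \<in> {a..b}" using sign_blocks_bounds[OF A Suc.prems] by auto
  \<comment> \<open>As \<open>v i = v' i\<close> by induction, \<open>u (Suc i)\<close> is an
    extremal point beyond block \<open>i\<close> of the second decomposition, which must therefore
    have a further block, starting no later.\<close>
  then have n: "i < k'" "u' (Suc i) \<le> u (Suc i)"
    using sign_blocks_next[OF B _ sign_blocks_abs_value(1)[OF A \<open>0 < M\<close> Suc.prems] \<open>i \<le> k'\<close>]
      sign_blocks_gap[OF A, of i] i by auto
  have "u' (Suc i) \<in> {a..b}" using sign_blocks_bounds[OF B, of "Suc i"] n by auto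
  then have "u (Suc i) \<le> u' (Suc i)"
    using sign_blocks_next[OF A _ sign_blocks_abs_value(1)[OF B \<open>0 < M\<close>, of "Suc i"], of i]
      sign_blocks_gap[OF B] i n by auto
  with n have "u (Suc i) = u' (Suc i)" by simp
  then show ?case
    using sign_blocks_unique_aux[OF A B \<open>0 < M\<close>, of "Suc i"]
      sign_blocks_unique_aux[OF B A \<open>0 < M\<close>, of "Suc i"] n Suc.prems by auto
qed

lemma sign_blocks_unique:
  assumes A: "sign_blocks a b f M k \<epsilon> u v" and B: "sign_blocks a b f M k' \<epsilon>' u' v'"
    and "0 < M"
  shows "k = k' \<and> \<epsilon> = \<epsilon>' \<and> (\<forall>i\<le>k. u i = u' i \<and> v i = v' i)"
proof (intro conjI allI impI)
  show "k = k'"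
    using sign_blocks_unique_step[OF A B \<open>0 < M\<close> order_refl]
      sign_blocks_unique_step[OF B A \<open>0 < M\<close> order_refl] by (elim conjE) (rule le_antisym)
  show "\<epsilon> = \<epsilon>'" using sign_blocks_first_eq(2)[OF A B \<open>0 < M\<close>] .
  fix i assume "i \<le> k"
  from sign_blocks_unique_step[OF A B \<open>0 < M\<close> this]
  show "u i = u' i" "v i = v' i" by simp_all
qed

section \<open>Existence of the blocks by a sweep from left to right\<close>

text \<open>End of the sweep: once no extremal point of the opposite sign remains, a single block
  covering all extremal points is enough.\<close>

lemma sign_blocks_singleI:
  assumes e: "\<epsilon> = -1 \<or> \<epsilon> = 1" and "x \<in> {c..b}" "y \<in> {c..b}" "x \<le> y"
    and "\<epsilon> * f x = M" "\<epsilon> * f y = M"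
    and bound: "\<And>t. t \<in> {c..b} \<Longrightarrow> \<bar>f t\<bar> \<le> M"
    and one_sign: "\<And>t. t \<in> {c..b} \<Longrightarrow> \<epsilon> * f t \<noteq> - M"
    and outside: "\<And>t. t \<in> {c..b} \<Longrightarrow> \<bar>f t\<bar> = M \<Longrightarrow> x \<le> t \<and> t \<le> y"
  shows "sign_blocks c b f M 0 \<epsilon> (\<lambda>_. x) (\<lambda>_. y)"
proof -
  have "- M < \<epsilon> * f t \<and> \<epsilon> * f t \<le> M" if "t \<in> {c..b}" for t
    using bound[OF that] one_sign[OF that] e by auto
  moreover have "\<bar>f t\<bar> < M" if "t \<in> {c..b}" "t \<notin> {x..y}" for t
    using bound[OF that(1)] outside[OF that(1)] that(2) by force
  ultimately show ?thesis
    using assms(1-6) unfolding sign_blocks_def by auto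
qed

text \<open>Inductive step of the sweep. Putting a block in front shifts all later indices by one,
  which flips \<open>(-1) ^ i\<close>; the sign \<open>- \<epsilon>\<close> of the tail compensates
  for this.\<close>

lemma sign_blocks_ConsI:
  assumes e: "\<epsilon> = -1 \<or> \<epsilon> = 1" and B: "sign_blocks w b f M k (- \<epsilon>) u v"
    and xy: "c \<le> x" "x \<le> y" "y < w" "w \<le> b"
    and vals: "\<epsilon> * f x = M" "\<epsilon> * f y = M"
    and bound: "\<And>t. t \<in> {c..b} \<Longrightarrow> \<bar>f t\<bar> \<le> M"
    and one_sign: "\<And>t. t \<in> {c..<w} \<Longrightarrow> \<epsilon> * f t \<noteq> - M"
    and outside: "\<And>t. t \<in> {c..<w} \<Longrightarrow> \<bar>f t\<bar> = M \<Longrightarrow> x \<le> t \<and> t \<le> y"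
  shows "sign_blocks c b f M (Suc k) \<epsilon> (case_nat x u) (case_nat y v)"
proof -
  \<comment> \<open>Splitting off index 0 lets \<open>case_nat\<close> reduce in every clause of the
    definition.\<close>
  have all_Suc: "(\<forall>i\<le>Suc k. P i) \<longleftrightarrow> P 0 \<and> (\<forall>i\<le>k. P (Suc i))" for P
    by (metis Suc_le_mono le0 not0_implies_Suc)
  have all_less_Suc: "(\<forall>i<Suc k. P i) \<longleftrightarrow> P 0 \<and> (\<forall>i<k. P (Suc i))" for P
    by (metis Suc_less_eq not0_implies_Suc zero_less_Suc)
  have "- M < \<epsilon> * f t \<and> \<epsilon> * f t \<le> M" if "t \<in> {x..y}" for t
    using bound[of t] one_sign[of t] that e xy by auto
  moreover have "\<bar>f t\<bar> < M" if "t \<in> {c..b}" "t \<notin> {x..y}" "\<forall>i\<le>k. t \<notin> {u i..v i}" for t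
  proof (cases "t < w")
    case True
    then show ?thesis using bound[of t] outside[of t] that by force
  next
    case False
    then show ?thesis using B that unfolding sign_blocks_def by auto
  qed
  moreover have "y < u 0" using sign_blocks_bounds(1)[OF B, of 0] xy by simp
  moreover have "v i < u (Suc i)" if "i < k" for i using sign_blocks_gap[OF B that] .
  moreover have "\<epsilon> * (\<epsilon> * z) = z" for z using e by auto
  ultimately show ?thesis
    using B xy e vals unfolding sign_blocks_def all_Suc all_less_Suc
    by (auto 0 3)
qed

text \<open>Induction on \<open>n\<close>, which bounds the remaining length in units of
  \<open>d\<close>: by \<open>sep\<close>, every change of sign uses up at least \<open>d\<close>.
  The point \<open>s\<close> guarantees that an extremal point is left to start from.\<close>

lemma sign_blocks_exist:
  assumes cont: "continuous_on {a..b} f" and "0 < M" "0 < d"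
    and bound: "\<And>t. t \<in> {a..b} \<Longrightarrow> \<bar>f t\<bar> \<le> M"
    and sep: "\<And>s t. s \<in> {a..b} \<Longrightarrow> t \<in> {a..b} \<Longrightarrow> \<bar>s - t\<bar> < d \<Longrightarrow> \<bar>f s - f t\<bar> < 2 * M"
    and "a \<le> c" "s \<in> {c..b}" "\<bar>f s\<bar> = M" "b - c < real n * d"
  shows "\<exists>k \<epsilon> u v. sign_blocks c b f M k \<epsilon> u v"
  using assms(6-)
proof (induction n arbitrary: c s)
  \<comment> \<open>Here \<open>b - c < 0\<close>, which contradicts
    \<open>s \<in> {c..b}\<close>.\<close>
  case 0
  then show ?case by auto
next
  case (Suc n)
  have sub: "continuous_on {c..b} f"
    using Suc.prems(1) by (intro continuous_on_subset[OF cont]) auto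
  obtain x where x: "x \<in> {c..b}" "\<bar>f x\<bar> = M"
    and x_min: "\<And>t. t \<in> {c..b} \<Longrightarrow> \<bar>f t\<bar> = M \<Longrightarrow> x \<le> t"
    using level_set_least[of c b "\<lambda>t. \<bar>f t\<bar>" s M] sub Suc.prems by (auto intro: continuous_intros)
  \<comment> \<open>The first extremal point \<open>x\<close> opens the first block and fixes its
    sign.\<close>
  define \<epsilon> where "\<epsilon> = sgn (f x)"
  have e: "\<epsilon> = -1 \<or> \<epsilon> = 1" and ex: "\<epsilon> * f x = M"
    using x(2) \<open>0 < M\<close> by (auto simp: \<epsilon>_def sgn_if)
  have bound': "\<bar>f t\<bar> \<le> M" if "t \<in> {c..b}" for t using bound[of t] that Suc.prems by auto
  have cases_abs: "\<epsilon> * f t = M \<or> \<epsilon> * f t = - M" if "\<bar>f t\<bar> = M" for t using that e by auto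
  show ?case
  proof (cases "\<exists>t\<in>{c..b}. \<epsilon> * f t = - M")
    case False
    obtain y where y: "y \<in> {c..b}" "\<bar>f y\<bar> = M"
      and y_max: "\<And>t. t \<in> {c..b} \<Longrightarrow> \<bar>f t\<bar> = M \<Longrightarrow> t \<le> y"
      using level_set_greatest[of c b "\<lambda>t. \<bar>f t\<bar>" s M] sub Suc.prems
      by (auto intro: continuous_intros)
    have "\<epsilon> * f y = M" using cases_abs[OF y(2)] y(1) False by auto
    then have "sign_blocks c b f M 0 \<epsilon> (\<lambda>_. x) (\<lambda>_. y)"
      using x y x_min y_max e ex bound' False by (intro sign_blocks_singleI) auto
    then show ?thesis by blast
  next
    case True
    then obtain r where r: "r \<in> {c..b}" "\<epsilon> * f r = - M" by blast
    \<comment> \<open>\<open>w\<close> is the first extremal point of the opposite sign, where the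
      next block begins; the current block ends at the last point \<open>y\<close> before it with
      \<open>\<epsilon> * f y = M\<close>.\<close>
    obtain w where w: "w \<in> {c..b}" "\<epsilon> * f w = - M"
      and w_min: "\<And>t. t \<in> {c..b} \<Longrightarrow> \<epsilon> * f t = - M \<Longrightarrow> w \<le> t"
      using level_set_least[OF continuous_on_mult_left[OF sub], of r \<epsilon> "- M"] r by blast
    have w_abs: "\<bar>f w\<bar> = M" using w(2) e \<open>0 < M\<close> by auto
    have "continuous_on {c..w} (\<lambda>t. \<epsilon> * f t)"
      using w by (intro continuous_intros continuous_on_subset[OF sub]) auto
    moreover have "x \<in> {c..w}" using x x_min[OF w(1) w_abs] by auto
    ultimately obtain y where y: "y \<in> {c..w}" "\<epsilon> * f y = M"
      and y_max: "\<And>t. t \<in> {c..w} \<Longrightarrow> \<epsilon> * f t = M \<Longrightarrow> t \<le> y"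
      using level_set_greatest[of c w "\<lambda>t. \<epsilon> * f t" x M] ex by metis
    \<comment> \<open>The values at \<open>y\<close> and \<open>w\<close> are opposite, so
      \<open>sep\<close> keeps these points at least \<open>d\<close> apart, and the interval from
      \<open>w\<close> on is short enough for the induction hypothesis.\<close>
    have "\<bar>f w - f y\<bar> = 2 * M" using w y e \<open>0 < M\<close> by auto
    then have "d \<le> \<bar>w - y\<bar>" using sep[of w y] w y Suc.prems by force
    then have yw: "y + d \<le> w" using y by auto
    have "b - w < real n * d" using Suc.prems yw y by (auto simp: algebra_simps)
    then obtain k \<epsilon>' u v where B: "sign_blocks w b f M k \<epsilon>' u v"
      using Suc.IH[of w w] w w_abs Suc.prems by auto
    \<comment> \<open>\<open>w\<close> is itself extremal, so the tail starts exactly there and has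
      the sign of \<open>f w\<close>, which is \<open>- \<epsilon>\<close>.\<close>
    have "u 0 = w"
      using sign_blocks_first[OF B, of w] sign_blocks_bounds(1)[OF B, of 0] w w_abs by auto
    then have "f w = \<epsilon>' * M" using sign_blocks_value(1)[OF B, of 0] by simp
    then have "\<epsilon>' = - \<epsilon>" using w(2) e sign_blocks_sign[OF B] \<open>0 < M\<close> by auto
    then have "sign_blocks c b f M (Suc k) \<epsilon> (case_nat x u) (case_nat y v)"
      using B
    proof (intro sign_blocks_ConsI[of \<epsilon> w])
      show "\<epsilon> * f t \<noteq> - M" if "t \<in> {c..<w}" for t using w_min[of t] that w by force
      then show "x \<le> t \<and> t \<le> y" if "t \<in> {c..<w}" "\<bar>f t\<bar> = M" for t
        using cases_abs[OF that(2)] that x_min[of t] y_max[of t] w by auto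
      show "x \<le> y" using y_max[of x] \<open>x \<in> {c..w}\<close> ex by auto
    qed (use e x w y yw ex bound' \<open>0 < d\<close> in auto)
    then show ?thesis by blast
  qed
qed

lemma alternation_exists:
  assumes "a < b" and cont: "continuous_on {a..b} f" and "0 < M"
    and bound: "\<And>t. t \<in> {a..b} \<Longrightarrow> \<bar>f t\<bar> \<le> M"
    and "p \<in> {a..b}" "f p = M" "q \<in> {a..b}" "f q = - M"
  shows "\<exists>k \<epsilon> u v. alternation a b f M k \<epsilon> u v"
proof -
  have "uniformly_continuous_on {a..b} f"
    using cont by (simp add: compact_uniformly_continuous)
  \<comment> \<open>The tolerance \<open>2 * M\<close> is the distance between the two extremal
    values.\<close>
  then obtain d where d: "0 < d" "\<forall>x\<in>{a..b}. \<forall>y\<in>{a..b}. dist y x < d \<longrightarrow> dist (f y) (f x) < 2 * M"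
    unfolding uniformly_continuous_on_def using \<open>0 < M\<close> by (metis mult_pos_pos zero_less_numeral)
  obtain n where "b - a < real n * d"
    using reals_Archimedean3[OF d(1)] by blast
  then obtain k \<epsilon> u v where A: "sign_blocks a b f M k \<epsilon> u v"
    using sign_blocks_exist[OF cont \<open>0 < M\<close> d(1) bound, of a p n] d(2) assms
    by (auto simp: dist_real_def)
  \<comment> \<open>A single block would give \<open>f\<close> the same value at all extremal
    points, but \<open>f\<close> takes both values \<open>M\<close> and \<open>- M\<close>.\<close>
  have "k \<noteq> 0"
  proof
    assume "k = 0"
    then have "f t = \<epsilon> * M" if "t \<in> {a..b}" "\<bar>f t\<bar> = M" for t
      using sign_blocks_extremal_value[OF A that] by force
    from this[of p] this[of q] show False using assms by auto
  qed
  then have "alternation a b f M k \<epsilon> u v"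
    using A by (simp add: alternation_iff_sign_blocks)
  then show ?thesis by blast
qed

section \<open>Lower bound for approximation by polynomials of low degree\<close>

text \<open>The intermediate value theorem gives a zero strictly between consecutive points
  \<open>u i\<close>, hence \<open>k\<close> distinct zeros. The factor \<open>c\<close> leaves the
  sign at \<open>u 0\<close> open.\<close>

lemma poly_sign_changes_le_degree:
  fixes p :: "real poly"
  assumes less: "\<And>i. i < k \<Longrightarrow> u i < u (Suc i)"
    and sign: "\<And>i. i \<le> k \<Longrightarrow> 0 < c * (-1) ^ i * poly p (u i)"
  shows "k \<le> degree p"
proof -
  have "\<exists>x. u i < x \<and> x < u (Suc i) \<and> poly p x = 0" if "i < k" for i
  proof -
    \<comment> \<open>Multiplying the conditions at \<open>i\<close> and \<open>Suc i\<close> leaves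
      a negative factor, minus a square, in front of the product of the two values.\<close>
    have "0 < (c * (-1) ^ i * poly p (u i)) * (c * (-1) ^ Suc i * poly p (u (Suc i)))"
      using that by (intro mult_pos_pos[OF sign sign]) auto
    also have "\<dots> = - (c * (-1) ^ i)\<^sup>2 * (poly p (u i) * poly p (u (Suc i)))"
      by (simp add: power2_eq_square algebra_simps)
    finally have "poly p (u i) * poly p (u (Suc i)) < 0"
      by (simp add: mult_less_0_iff zero_less_mult_iff)
    then show ?thesis using poly_IVT[OF less[OF that]] by blast
  qed
  then obtain x where x: "\<And>i. i < k \<Longrightarrow> u i < x i \<and> x i < u (Suc i) \<and> poly p (x i) = 0"
    by metis
  have mono: "u i \<le> u j" if "i \<le> j" "j \<le> k" for i j
    using that
  proof (induction rule: dec_induct)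
    case (step n)
    then show ?case using less[of n] by simp
  qed simp
  have "x i < x j" if "i < j" "j < k" for i j
    using x[of i] x[of j] mono[of "Suc i" j] that by auto
  then have "inj_on x {..<k}"
    by (intro inj_onI) (metis lessThan_iff less_irrefl linorder_neqE_nat)
  then have "k = card (x ` {..<k})" by (simp add: card_image)
  moreover have "p \<noteq> 0" using sign[of 0] by auto
  moreover have "card (x ` {..<k}) \<le> card {z. poly p z = 0}"
    using x \<open>p \<noteq> 0\<close> by (intro card_mono) (auto simp: poly_roots_finite)
  ultimately show ?thesis using card_poly_roots_bound[of p] by linarith
qed

lemma alternation_le_unorm_diff:
  assumes "a \<le> b" "continuous_on {a..b} f" "0 < M" and A: "alternation a b f M k \<epsilon> u v"
    and deg: "degree p \<le> k - 1"
  shows "M \<le> unorm a b (\<lambda>t. f t - poly p t)"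
proof (rule ccontr)
  assume less: "\<not> M \<le> unorm a b (\<lambda>t. f t - poly p t)"
  have k: "1 \<le> k" and B: "sign_blocks a b f M k \<epsilon> u v"
    using A by (auto simp: alternation_iff_sign_blocks)
  have "continuous_on {a..b} (\<lambda>t. f t - poly p t)"
    using assms by (intro continuous_intros)
  then have near: "\<bar>f t - poly p t\<bar> < M" if "t \<in> {a..b}" for t
    using unorm_is_maximum[OF \<open>a \<le> b\<close>] less that by force
  have "k \<le> degree p"
  proof (rule poly_sign_changes_le_degree)
    show "u i < u (Suc i)" if "i < k" for i
      using sign_blocks_gap[OF B that] sign_blocks_bounds(2)[OF B, of i] that by auto
    show "0 < \<epsilon> * (-1) ^ i * poly p (u i)" if "i \<le> k" for i
    proof -
      \<comment> \<open>Since \<open>f (u i)\<close> is \<open>M\<close> or \<open>- M\<close> and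
        \<open>p\<close> differs from it by less than \<open>M\<close>, \<open>p\<close> cannot
        reach zero there.\<close>
      have "\<epsilon> * (-1) ^ i = 1 \<or> \<epsilon> * (-1) ^ i = -1"
        using sign_blocks_sign[OF B] by (cases "even i") auto
      then show ?thesis
        using near[of "u i"] sign_blocks_bounds[OF B that] sign_blocks_value(1)[OF B that]
        by (elim disjE) auto
    qed
  qed
  \<comment> \<open>Subtraction on naturals is truncated; \<open>1 \<le> k\<close> makes
    \<open>k - 1\<close> properly smaller than \<open>k\<close>.\<close>
  then show False using deg k by auto
qed

section \<open>Lowering the norm by a small multiple of the product polynomial\<close>

lemma prod_linear_poly:
  fixes c :: "'a::field"
  assumes "c \<noteq> 0"
  shows "\<exists>q. degree q = k \<and> (\<lambda>t. c * (\<Prod>i<k. \<xi> i - t)) = poly q"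
proof (intro exI conjI)
  let ?q = "smult c (\<Prod>i<k. [:\<xi> i, -1:])"
  show "degree ?q = k"
    using assms by (simp add: degree_prod_eq_sum_degree)
  show "(\<lambda>t. c * (\<Prod>i<k. \<xi> i - t)) = poly ?q"
    by (auto simp: poly_prod)
qed

text \<open>Exactly the first \<open>i\<close> factors are negative.\<close>

lemma prod_linear_sign:
  fixes t :: real
  assumes "i \<le> k" "\<And>j. j < i \<Longrightarrow> \<xi> j < t" "\<And>j. i \<le> j \<Longrightarrow> j < k \<Longrightarrow> t < \<xi> j"
  shows "0 < (-1) ^ i * (\<Prod>j<k. \<xi> j - t)"
proof -
  have "{..<k} = {..<i} \<union> {i..<k}" using assms(1) by auto
  then have "(\<Prod>j<k. \<xi> j - t) = (\<Prod>j<i. \<xi> j - t) * (\<Prod>j=i..<k. \<xi> j - t)"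
    by (simp add: prod.union_disjoint ivl_disj_int)
  also have "(\<Prod>j<i. \<xi> j - t) = (\<Prod>j<i. (-1) * (t - \<xi> j))"
    by (intro prod.cong) auto
  also have "\<dots> = (-1) ^ i * (\<Prod>j<i. t - \<xi> j)"
    by (subst prod.distrib) simp
  finally have "(-1) ^ i * (\<Prod>j<k. \<xi> j - t) = (\<Prod>j<i. t - \<xi> j) * (\<Prod>j=i..<k. \<xi> j - t)"
    by (simp add: power_mult_distrib[symmetric] mult.assoc[symmetric])
  also have "\<dots> > 0"
    using assms by (intro mult_pos_pos prod_pos) auto
  finally show ?thesis .
qed

text \<open>On the compact set \<open>K\<close> where \<open>f\<close> and \<open>g\<close> do not
  share a strict sign, \<open>\<bar>f t\<bar>\<close> stays below \<open>M\<close> by a fixed margin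
  \<open>d\<close>, which absorbs a small perturbation. Off \<open>K\<close>, subtracting a small
  multiple of \<open>g\<close> moves the value towards zero or just past it.\<close>

lemma unorm_diff_less:
  fixes f g :: "real \<Rightarrow> real"
  assumes "a \<le> b" and cf: "continuous_on {a..b} f" and cg: "continuous_on {a..b} g" and "0 < M"
    and bound: "\<And>t. t \<in> {a..b} \<Longrightarrow> \<bar>f t\<bar> \<le> M"
    and same_sign: "\<And>t. t \<in> {a..b} \<Longrightarrow> \<bar>f t\<bar> = M \<Longrightarrow> 0 < f t * g t"
  shows "\<forall>\<^sub>F l in at_right 0. unorm a b (\<lambda>t. f t - l * g t) < M"
proof -
  define K where "K = {t \<in> {a..b}. f t * g t \<le> 0}"
  have "K = {a..b} \<inter> (\<lambda>t. f t * g t) -` {..0}" by (auto simp: K_def)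
  also have "closed \<dots>"
    using cf cg by (intro continuous_closed_preimage continuous_intros) auto
  finally have "compact K" by (rule compact_closed_subset_Icc) (auto simp: K_def)
  have K_less: "\<bar>f t\<bar> < M" if "t \<in> K" for t
    using bound[of t] same_sign[of t] that by (force simp: K_def)
  obtain d where d: "0 < d" "d \<le> M" "\<And>t. t \<in> K \<Longrightarrow> \<bar>f t\<bar> \<le> M - d"
  proof (cases "K = {}")
    case True
    \<comment> \<open>With \<open>K\<close> empty the margin is arbitrary; \<open>M\<close> also
      meets the demand \<open>d \<le> M\<close>.\<close>
    then show ?thesis using that[of M] \<open>0 < M\<close> by auto
  next
    case False
    have "continuous_on K (\<lambda>t. \<bar>f t\<bar>)"
      using cf by (intro continuous_intros) (auto simp: K_def intro: continuous_on_subset)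
    then obtain s where "s \<in> K" "\<forall>t\<in>K. \<bar>f t\<bar> \<le> \<bar>f s\<bar>"
      using continuous_attains_sup[OF \<open>compact K\<close> False] by blast
    then show ?thesis using that[of "M - \<bar>f s\<bar>"] K_less by auto
  qed
  \<comment> \<open>Adding 1 makes the bound on \<open>g\<close> strict and \<open>G\<close>
    positive, so that \<open>d / G\<close> is a legitimate threshold for \<open>l\<close>.\<close>
  define G where "G = unorm a b g + 1"
  have G: "\<bar>g t\<bar> < G" if "t \<in> {a..b}" for t
    using unorm_is_maximum[OF \<open>a \<le> b\<close> cg] that by (force simp: G_def)
  have "0 < G" using G[of a] \<open>a \<le> b\<close> by auto
  have "unorm a b (\<lambda>t. f t - l * g t) < M" if l: "0 < l" "l < d / G" for l
  proof -
    have lG: "\<bar>l * g t\<bar> < d" if "t \<in> {a..b}" for t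
    proof -
      have "\<bar>l * g t\<bar> < l * G" using G[OF that] l by (simp add: abs_mult)
      also have "\<dots> < d" using l \<open>0 < G\<close> by (simp add: field_simps)
      finally show ?thesis .
    qed
    have less: "\<bar>f t - l * g t\<bar> < M" if t: "t \<in> {a..b}" for t
    proof (cases "t \<in> K")
      case True
      then show ?thesis using d(3)[OF True] lG[OF t] by auto
    next
      case False
      then have "0 < f t \<and> 0 < g t \<or> f t < 0 \<and> g t < 0"
        using t by (auto simp: K_def not_le zero_less_mult_iff)
      then have "0 < f t \<and> 0 < l * g t \<or> f t < 0 \<and> l * g t < 0"
        using l by (auto simp: mult_pos_neg)
      \<comment> \<open>Either the subtraction shrinks \<open>\<bar>f t\<bar>\<close>, or it
        overshoots zero by less than \<open>d \<le> M\<close>.\<close>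
      then show ?thesis using bound[OF t] lG[OF t] d(2) by auto
    qed
    have "continuous_on {a..b} (\<lambda>t. f t - l * g t)"
      using cf cg by (intro continuous_intros)
    \<comment> \<open>The norm is attained, so the strict pointwise bound passes to it.\<close>
    from unorm_is_maximum[OF \<open>a \<le> b\<close> this] show ?thesis using less by metis
  qed
  moreover have "0 < d / G" using d \<open>0 < G\<close> by simp
  ultimately show ?thesis
    unfolding eventually_at_right_field by blast
qed

text \<open>The points \<open>\<xi> j\<close> separate the blocks: for \<open>t\<close> in block
  \<open>i\<close> exactly those with \<open>j < i\<close> lie to its left, so the product has the
  sign \<open>(-1) ^ i\<close> there.\<close>

lemma alternation_unorm_diff_less:
  assumes "a \<le> b" and cf: "continuous_on {a..b} f" and "0 < M"
    and bound: "\<And>t. t \<in> {a..b} \<Longrightarrow> \<bar>f t\<bar> \<le> M"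
    and A: "alternation a b f M k \<epsilon> u v"
    and \<xi>: "\<And>i. i < k \<Longrightarrow> \<xi> i \<in> {v i<..<u (Suc i)}"
  shows "\<forall>\<^sub>F l in at_right 0. unorm a b (\<lambda>t. f t - l * (\<epsilon> * (\<Prod>i<k. \<xi> i - t))) < M"
proof (rule unorm_diff_less[OF \<open>a \<le> b\<close> cf _ \<open>0 < M\<close> bound])
  show "continuous_on {a..b} (\<lambda>t. \<epsilon> * (\<Prod>i<k. \<xi> i - t))"
    by (intro continuous_intros)
next
  have B: "sign_blocks a b f M k \<epsilon> u v"
    using A by (auto simp: alternation_iff_sign_blocks)
  fix t assume "t \<in> {a..b}" "\<bar>f t\<bar> = M"
  then obtain i where i: "i \<le> k" "u i \<le> t" "t \<le> v i" "f t = \<epsilon> * (-1) ^ i * M"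
    using sign_blocks_extremal_value[OF B] by blast
  have "0 < (-1) ^ i * (\<Prod>j<k. \<xi> j - t)"
  proof (rule prod_linear_sign[OF \<open>i \<le> k\<close>])
    show "\<xi> j < t" if "j < i" for j
      using \<xi>[of j] sign_blocks_left_mono[OF B, of "Suc j" i] that i by auto
    show "t < \<xi> j" if "i \<le> j" "j < k" for j
      using \<xi>[of j] sign_blocks_right_mono[OF B, of i j] that i by auto
  qed
  \<comment> \<open>The factor \<open>\<epsilon>\<^sup>2 = 1\<close> collects one
    \<open>\<epsilon>\<close> from \<open>f t\<close> and one from the polynomial.\<close>
  then have "0 < \<epsilon>\<^sup>2 * (M * ((-1) ^ i * (\<Prod>j<k. \<xi> j - t)))"
    using sign_blocks_sign[OF B] mult_pos_pos[OF \<open>0 < M\<close>] by auto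
  then show "0 < f t * (\<epsilon> * (\<Prod>j<k. \<xi> j - t))"
    using i(4) by (simp add: power2_eq_square mult_ac)
qed auto

section \<open>Assembly of existence, uniqueness and the two norm estimates\<close>

theorem theorem2p1:
  fixes a b M :: real and f :: "real \<Rightarrow> real"
  assumes "a < b"
    and "continuous_on {a..b} f"
    and "M = (SUP t\<in>{a..b}. f t)"
    and "M = - (INF t\<in>{a..b}. f t)"
    and "M > 0"
  shows
    "(\<exists>k \<epsilon> u v. alternation a b f M k \<epsilon> u v) \<and>
     (\<forall>k \<epsilon> u v k' \<epsilon>' u' v'.
        alternation a b f M k \<epsilon> u v \<longrightarrow> alternation a b f M k' \<epsilon>' u' v' \<longrightarrow>
        k = k' \<and> \<epsilon> = \<epsilon>' \<and> (\<forall>i\<le>k. u i = u' i \<and> v i = v' i)) \<and>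
     (\<forall>k \<epsilon> u v. alternation a b f M k \<epsilon> u v \<longrightarrow>
        (\<forall>p :: real poly. degree p \<le> k - 1 \<longrightarrow>
           unorm a b (\<lambda>t. f t - poly p t) \<ge> unorm a b f)) \<and>
     (\<forall>k \<epsilon> u v \<xi> \<gamma>. alternation a b f M k \<epsilon> u v \<longrightarrow>
        (\<forall>i<k. \<xi> i \<in> {v i<..<u (Suc i)}) \<longrightarrow>
        \<gamma> = (\<lambda>t. \<epsilon> * (\<Prod>i<k. \<xi> i - t)) \<longrightarrow>
        (\<exists>q :: real poly. degree q = k \<and> \<gamma> = poly q) \<and>
        (\<forall>\<^sub>F l in at_right 0. unorm a b (\<lambda>t. f t - l * \<gamma> t) < unorm a b f))"
proof -
  obtain p where p: "p \<in> {a..b}" "f p = M" and upper: "\<forall>t\<in>{a..b}. f t \<le> M"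
    using SUP_is_maximum[of a b f] assms(1-3) by auto
  obtain q where q: "q \<in> {a..b}" "f q = - M" and lower: "\<forall>t\<in>{a..b}. - M \<le> f t"
    using INF_is_minimum[of a b f] assms(1,2,4) by auto
  have bound: "\<bar>f t\<bar> \<le> M" if "t \<in> {a..b}" for t
    using upper lower that by (auto simp: abs_le_iff minus_le_iff)
  \<comment> \<open>Positivity of \<open>M\<close> turns \<open>f p = M\<close> into
    \<open>\<bar>f p\<bar> = M\<close>, so the bound \<open>M\<close> on the absolute value is
    attained.\<close>
  have norm: "unorm a b f = M"
    unfolding unorm_def using p \<open>M > 0\<close> bound
    by (intro cSup_eq_maximum) (auto intro!: image_eqI[of _ _ p])
  have le: "a \<le> b" using assms(1) by simp
  show ?thesis
    unfolding norm
  proof (intro conjI allI impI)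
    show "\<exists>k \<epsilon> u v. alternation a b f M k \<epsilon> u v"
      using alternation_exists[OF assms(1,2,5) bound p q] .
  next
    fix k \<epsilon> u v k' \<epsilon>' u' v'
    assume "alternation a b f M k \<epsilon> u v" "alternation a b f M k' \<epsilon>' u' v'"
    then have *: "k = k' \<and> \<epsilon> = \<epsilon>' \<and> (\<forall>i\<le>k. u i = u' i \<and> v i = v' i)"
      unfolding alternation_iff_sign_blocks using sign_blocks_unique[OF _ _ \<open>M > 0\<close>] by blast
    show "k = k'" "\<epsilon> = \<epsilon>'" using * by auto
    show "u i = u' i" "v i = v' i" if "i \<le> k" for i using * that by auto
  next
    fix k \<epsilon> u v and p :: "real poly"
    assume "alternation a b f M k \<epsilon> u v" "degree p \<le> k - 1"
    then show "M \<le> unorm a b (\<lambda>t. f t - poly p t)"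
      by (rule alternation_le_unorm_diff[OF le assms(2,5)])
  next
    fix k \<epsilon> u v \<xi> \<gamma>
    assume A: "alternation a b f M k \<epsilon> u v" and \<xi>: "\<forall>i<k. \<xi> i \<in> {v i<..<u (Suc i)}"
      and \<gamma>: "\<gamma> = (\<lambda>t. \<epsilon> * (\<Prod>i<k. \<xi> i - t))"
    have "\<epsilon> \<noteq> 0" using A by (auto simp: alternation_def)
    then show "\<exists>q. degree q = k \<and> \<gamma> = poly q"
      unfolding \<gamma> by (rule prod_linear_poly)
    show "\<forall>\<^sub>F l in at_right 0. unorm a b (\<lambda>t. f t - l * \<gamma> t) < M"
      unfolding \<gamma> using \<xi> by (intro alternation_unorm_diff_less[OF le assms(2,5) bound A]) auto
  qed
qed

end
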